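(* Let $X$ be a real Hilbert space and let $\mathsf F:X\to X^\star$ satisfy (F1), (F2) and (F3). Assume that the forms $a(u;\cdot,\cdot)$, $u\in X$, are uniformly coercive and bounded with constants $\alpha,\beta>0$, and let $\{u^n\}_{n\ge 0}\subset X$ be the sequence generated by the iterative linearization scheme $$\mathsf A[u^n]u^{n+1}=\mathsf A[u^n]u^n-\mathsf F(u^n),\qquad n\ge 0,$$ from an initial guess $u^0\in X$. Assume moreover that this sequence satisfies (F4). Then $\{u^n\}_{n\ge0}$ converges in $X$ to the unique solution $u^\star\in X$ of $\mathsf F(u)=0$ in $X^\star$.
   Context: $X$ is a real Hilbert space with inner product $(\cdot,\cdot)_X$, norm $\|\cdot\|_X$, dual $X^\star$ and duality pairing $\langle\cdot,\cdot\rangle$ on $X^\star\times X$. Conditions on $\mathsf F:X\to X^\star$: (F1) there is $L_{\mathsf F}>0$ with $|\langle \mathsf F(u)-\mathsf F(v),w\rangle|\le L_{\mathsf F}\|u-v\|_X\|w\|_X$ for all $u,v,w\in X$; (F2) there is $\nu>0$ with $\nu\|u-v\|_X^2\le\langle \mathsf F(u)-\mathsf F(v),u-v\rangle$ for all $u,v\in X$; (F3) there is a Gâteaux differentiable functional $\mathsf H:X\to\mathbb R$ with $\mathsf H'=\mathsf F$. Under (F1)–(F2), the equation $\mathsf F(u)=0$ has a unique solution $u^\star\in X$. For each $v\in X$, $\mathsf A[v]:X\to X^\star$ is a given linear invertible operator, and $a(u;v,w):=\langle \mathsf A[u]v,w\rangle$. Uniform coercivity and boundedness mean: there are $\alpha,\beta>0$,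 independent of $u\in X$, with $a(u;v,v)\ge\alpha\|v\|_X^2$ and $a(u;v,w)\le\beta\|v\|_X\|w\|_X$ for all $u,v,w\in X$. (F4) There is a constant $C_{\mathsf H}>0$ such that $\mathsf H(u^{n-1})-\mathsf H(u^n)\ge C_{\mathsf H}\|u^n-u^{n-1}\|_X^2$ for all $n\ge1$, where $\mathsf H$ is the potential from (F3). *)

theory Defs
  imports "HOL-Analysis.Analysis"
begin

text \<open>A real Hilbert space is a type of sort \<open>{real_inner, complete_space}\<close>. Its topological
  dual is the type of bounded linear functionals, and the duality pairing is \<open>blinfun_apply\<close>.\<close>

type_synonym 'a dual = "'a \<Rightarrow>\<^sub>L real"

definition lipschitz_operator :: "('a::real_inner \<Rightarrow> 'a dual) \<Rightarrow> bool" where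
  "lipschitz_operator F \<longleftrightarrow>
     (\<exists>L>0. \<forall>u v w. \<bar>blinfun_apply (F u - F v) w\<bar> \<le> L * norm (u - v) * norm w)"

definition strongly_monotone :: "('a::real_inner \<Rightarrow> 'a dual) \<Rightarrow> bool" where
  "strongly_monotone F \<longleftrightarrow>
     (\<exists>\<nu>>0. \<forall>u v. \<nu> * (norm (u - v))\<^sup>2 \<le> blinfun_apply (F u - F v) (u - v))"

text \<open>The Gateaux derivative at a point is required to be a bounded linear functional, which is
  built into the type of \<open>D\<close>.\<close>

definition has_gateaux_derivative :: "('a::real_normed_vector \<Rightarrow> real) \<Rightarrow> 'a dual \<Rightarrow> 'a \<Rightarrow> bool" where
  "has_gateaux_derivative H D u \<longleftrightarrow>
     (\<forall>w. ((\<lambda>t::real. (H (u + t *\<^sub>R w) - H u) / t) \<longlongrightarrow> blinfun_apply D w) (at 0))"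

definition potential_of :: "('a::real_normed_vector \<Rightarrow> real) \<Rightarrow> ('a \<Rightarrow> 'a dual) \<Rightarrow> bool" where
  "potential_of H F \<longleftrightarrow> (\<forall>u. has_gateaux_derivative H (F u) u)"

definition lin_form :: "('a \<Rightarrow> 'a \<Rightarrow> 'a dual) \<Rightarrow> 'a \<Rightarrow> 'a \<Rightarrow> 'a::real_normed_vector \<Rightarrow> real" where
  "lin_form A u v w = blinfun_apply (A u v) w"

definition uniformly_coercive ::
    "('a::real_normed_vector \<Rightarrow> 'a \<Rightarrow> 'a \<Rightarrow> real) \<Rightarrow> real \<Rightarrow> bool" where
  "uniformly_coercive a \<alpha> \<longleftrightarrow> (\<forall>u v. a u v v \<ge> \<alpha> * (norm v)\<^sup>2)"

definition uniformly_bounded ::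
    "('a::real_normed_vector \<Rightarrow> 'a \<Rightarrow> 'a \<Rightarrow> real) \<Rightarrow> real \<Rightarrow> bool" where
  "uniformly_bounded a \<beta> \<longleftrightarrow> (\<forall>u v w. a u v w \<le> \<beta> * norm v * norm w)"

definition linearization_scheme ::
    "('a \<Rightarrow> 'a \<Rightarrow> 'a dual) \<Rightarrow> ('a \<Rightarrow> 'a dual) \<Rightarrow> (nat \<Rightarrow> 'a::real_normed_vector) \<Rightarrow> bool" where
  "linearization_scheme A F u \<longleftrightarrow>
     (\<forall>n. A (u n) (u (Suc n)) = A (u n) (u n) - F (u n))"

definition energy_decay :: "('a::real_normed_vector \<Rightarrow> real) \<Rightarrow> (nat \<Rightarrow> 'a) \<Rightarrow> bool" where
  "energy_decay H u \<longleftrightarrow>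
     (\<exists>C>0. \<forall>n\<ge>1. H (u (n - 1)) - H (u n) \<ge> C * (norm (u n - u (n - 1)))\<^sup>2)"

end

theory Submission
  imports Defs
begin

text \<open>Strong monotonicity makes the potential bounded below, so the energy decay forces the
  increments of the iteration to be square summable, hence null. By boundedness of the forms
  the residuals \<open>F (u n)\<close> then tend to zero, and \<open>\<nu> \<parallel>v - w\<parallel> \<le> \<parallel>F v - F w\<parallel>\<close>
  turns this into a Cauchy property of the iterates. By continuity of \<open>F\<close> their limit is a zero of
  \<open>F\<close>; in particular existence of the zero comes from the iteration itself.\<close>

text \<open>The difference quotient of \<open>s \<mapsto> H (x + s *\<^sub>R w)\<close> at
  \<open>t\<close> is the Gateaux quotient at \<open>x + t *\<^sub>R w\<close> in direction
  \<open>w\<close>. This brings one-variable calculus to bear on \<open>H\<close>.\<close>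

lemma has_gateaux_derivative_line:
  assumes "has_gateaux_derivative H D (x + t *\<^sub>R w)"
  shows "((\<lambda>s. H (x + s *\<^sub>R w)) has_real_derivative blinfun_apply D w) (at t)"
  using assms unfolding has_gateaux_derivative_def DERIV_def
  by (simp add: scaleR_add_left add.assoc)

text \<open>The gap between the two sides, with \<open>w\<close> replaced by
  \<open>t *\<^sub>R w\<close>, is \<open>g t - g 0\<close>. Strong monotonicity makes the
  derivative of \<open>g\<close> nonnegative on the unit interval.\<close>

lemma strongly_monotone_potential_lower_bound:
  assumes "potential_of H F"
    and mono: "\<And>u v. \<nu> * (norm (u - v))\<^sup>2 \<le> blinfun_apply (F u - F v) (u - v)"
  shows "H x + blinfun_apply (F x) w + \<nu> / 2 * (norm w)\<^sup>2 \<le> H (x + w)"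
proof -
  define g where
    "g t = H (x + t *\<^sub>R w) - t * blinfun_apply (F x) w - \<nu> / 2 * t\<^sup>2 * (norm w)\<^sup>2" for t :: real
  have "g 0 \<le> g 1"
  proof (rule DERIV_nonneg_imp_nondecreasing[of 0 1 g])
    fix t :: real assume "0 \<le> t" "t \<le> 1"
    let ?d = "blinfun_apply (F (x + t *\<^sub>R w)) w - blinfun_apply (F x) w - \<nu> * t * (norm w)\<^sup>2"
    have "has_gateaux_derivative H (F (x + t *\<^sub>R w)) (x + t *\<^sub>R w)"
      using assms(1) by (simp add: potential_of_def)
    note has_gateaux_derivative_line [OF this, derivative_intros]
    have "(g has_real_derivative ?d) (at t)"
      unfolding g_def by (auto intro!: derivative_eq_intros)
    moreover have "0 \<le> ?d"
    proof (cases "t = 0")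
      case False
      \<comment> \<open>The two points differ by \<open>t *\<^sub>R w\<close>, so monotonicity
        yields the desired inequality multiplied by \<open>t\<close>. The factor cancels only for
        positive \<open>t\<close>; at \<open>t = 0\<close> the derivative is zero outright.\<close>
      have "0 \<le> t * ?d"
        using mono[of "x + t *\<^sub>R w" x]
        by (simp add: blinfun.diff_left blinfun.scaleR_right power_mult_distrib
            power2_eq_square algebra_simps)
      then show ?thesis
        using False \<open>0 \<le> t\<close> by (simp add: zero_le_mult_iff)
    qed simp
    ultimately show "\<exists>d. (g has_real_derivative d) (at t) \<and> 0 \<le> d" by blast
  qed simp
  then show ?thesis by (simp add: g_def)
qed

text \<open>In the quadratic lower bound at the origin, the linear term is at worst
  \<open>- norm (F 0) * norm v\<close>, and the quadratic term absorbs it.\<close>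

lemma strongly_monotone_potential_bdd_below:
  assumes "potential_of H F" and "strongly_monotone F"
  shows "bdd_below (range H)"
proof -
  obtain \<nu> where "\<nu> > 0"
    and mono: "\<And>u v. \<nu> * (norm (u - v))\<^sup>2 \<le> blinfun_apply (F u - F v) (u - v)"
    using assms(2) unfolding strongly_monotone_def by blast
  show ?thesis
  proof (rule bdd_belowI2)
    fix v
    let ?c = "norm (F 0)"
    have "- (?c * norm v) \<le> blinfun_apply (F 0) v"
      using norm_blinfun[of "F 0" v] by simp
    \<comment> \<open>The left side is the minimum of the real function
      \<open>\<nu> / 2 * s\<^sup>2 - ?c * s\<close>, attained at \<open>s = ?c / \<nu>\<close>;
      completing the square shows this.\<close>
    moreover have "- (?c\<^sup>2 / (2 * \<nu>)) \<le> \<nu> / 2 * (norm v)\<^sup>2 - ?c * norm v"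
    proof -
      have "\<nu> / 2 * (norm v)\<^sup>2 - ?c * norm v + ?c\<^sup>2 / (2 * \<nu>) = (\<nu> * norm v - ?c)\<^sup>2 / (2 * \<nu>)"
        using \<open>\<nu> > 0\<close> by (simp add: field_simps power2_eq_square)
      also have "\<dots> \<ge> 0" using \<open>\<nu> > 0\<close> by simp
      finally show ?thesis by simp
    qed
    moreover have "H 0 + blinfun_apply (F 0) v + \<nu> / 2 * (norm v)\<^sup>2 \<le> H v"
      using strongly_monotone_potential_lower_bound[OF assms(1) mono, of 0 v] by simp
    ultimately show "H 0 - ?c\<^sup>2 / (2 * \<nu>) \<le> H v" by linarith
  qed
qed

text \<open>The pairing is at most the dual norm times \<open>norm (u - v)\<close>, and one factor
  \<open>norm (u - v)\<close> cancels. Distances between points are thus controlled by their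
  residuals.\<close>

lemma strongly_monotone_norm_le:
  assumes "strongly_monotone F"
  obtains \<nu> where "\<nu> > 0" "\<And>u v. \<nu> * norm (u - v) \<le> norm (F u - F v)"
proof -
  obtain \<nu> where "\<nu> > 0"
    and mono: "\<And>u v. \<nu> * (norm (u - v))\<^sup>2 \<le> blinfun_apply (F u - F v) (u - v)"
    using assms unfolding strongly_monotone_def by blast
  have "\<nu> * norm (u - v) \<le> norm (F u - F v)" for u v
  proof (cases "u = v")
    case False
    have "\<nu> * norm (u - v) * norm (u - v) \<le> norm (F u - F v) * norm (u - v)"
      using mono[of u v] norm_blinfun[of "F u - F v" "u - v"]
      by (simp add: power2_eq_square)
    then show ?thesis using False by simp
  qed simp
  with \<open>\<nu> > 0\<close> that show thesis by blast
qed

lemma strongly_monotone_inj: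
  assumes "strongly_monotone F"
  shows "inj F"
proof -
  obtain \<nu> where "\<nu> > 0" and \<nu>: "\<And>u v. \<nu> * norm (u - v) \<le> norm (F u - F v)"
    using strongly_monotone_norm_le[OF assms] by blast
  show ?thesis
  proof (rule injI)
    fix x y assume "F x = F y"
    with \<nu>[of x y] \<open>\<nu> > 0\<close> show "x = y" by (simp add: mult_le_0_iff)
  qed
qed

lemma lipschitz_operator_continuous:
  assumes "lipschitz_operator F"
  shows "continuous_on UNIV F"
proof -
  obtain L where L: "L > 0"
    "\<And>u v w. \<bar>blinfun_apply (F u - F v) w\<bar> \<le> L * norm (u - v) * norm w"
    using assms unfolding lipschitz_operator_def by blast
  have "norm (F u - F v) \<le> L * norm (u - v)" for u v
    using L by (intro norm_blinfun_bound) auto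
  then have "L-lipschitz_on UNIV F"
    using L(1) by (intro lipschitz_onI) (auto simp: dist_norm)
  then show ?thesis by (rule lipschitz_on_continuous_on)
qed

text \<open>The energies decrease and are bounded below, hence converge. Their successive
  differences tend to zero and dominate \<open>C\<close> times the squared increments.\<close>

lemma energy_decay_increments_null:
  assumes "energy_decay H u" and "bdd_below (range H)"
  shows "(\<lambda>n. norm (u (Suc n) - u n)) \<longlonglongrightarrow> 0"
proof -
  obtain C where "C > 0"
    and "\<And>n. n \<ge> 1 \<Longrightarrow> H (u (n - 1)) - H (u n) \<ge> C * (norm (u n - u (n - 1)))\<^sup>2"
    using assms(1) unfolding energy_decay_def by blast
  from this(2)[of "Suc n" for n]
  have decay: "C * (norm (u (Suc n) - u n))\<^sup>2 \<le> H (u n) - H (u (Suc n))" for n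
    by simp
  have "0 \<le> C * (norm (u (Suc n) - u n))\<^sup>2" for n
    using \<open>C > 0\<close> by simp
  with decay have "decseq (\<lambda>n. H (u n))"
    by (intro decseq_SucI) (smt (verit))
  moreover obtain b where "\<And>v. b \<le> H v"
    using assms(2) by (auto simp: bdd_below_def)
  ultimately obtain l where l: "(\<lambda>n. H (u n)) \<longlonglongrightarrow> l"
    using decseq_convergent[of "\<lambda>n. H (u n)" b] by blast
  have "(\<lambda>n. (H (u n) - H (u (Suc n))) / C) \<longlonglongrightarrow> (l - l) / C"
    using l LIMSEQ_Suc[OF l] \<open>C > 0\<close> by (intro tendsto_intros) auto
  then have "(\<lambda>n. (H (u n) - H (u (Suc n))) / C) \<longlonglongrightarrow> 0" by simp
  then have "(\<lambda>n. (norm (u (Suc n) - u n))\<^sup>2) \<longlonglongrightarrow> 0"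
    by (rule tendsto_sandwich[rotated 2, OF tendsto_const])
      (use decay \<open>C > 0\<close> in \<open>auto simp: field_simps\<close>)
  then show ?thesis
    using tendsto_real_sqrt[of "\<lambda>n. (norm (u (Suc n) - u n))\<^sup>2" 0] by simp
qed

text \<open>By linearity the scheme says that the residual is \<open>A (u n)\<close> applied to the
  negative increment, so boundedness of the form estimates it.\<close>

lemma linearization_scheme_residual_le:
  assumes scheme: "linearization_scheme A F u" and lin: "\<And>v. linear (A v)"
    and bounded: "uniformly_bounded (lin_form A) \<beta>" and "\<beta> \<ge> 0"
  shows "norm (F (u n)) \<le> \<beta> * norm (u (Suc n) - u n)"
proof -
  have eq: "F (u n) = A (u n) (u n - u (Suc n))"
    using scheme linear_diff[OF lin] by (simp add: linearization_scheme_def)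
  have le: "blinfun_apply (F (u n)) w \<le> \<beta> * norm (u (Suc n) - u n) * norm w" for w
    using bounded
    by (simp add: eq uniformly_bounded_def lin_form_def norm_minus_commute[of "u (Suc n)"])
  \<comment> \<open>\<open>uniformly_bounded\<close> bounds the form only from above; testing with
    \<open>- w\<close> as well gives the absolute value.\<close>
  have "norm (blinfun_apply (F (u n)) w) \<le> \<beta> * norm (u (Suc n) - u n) * norm w" for w
    using le[of w] le[of "- w"] by (simp add: blinfun.minus_right abs_le_iff)
  then show ?thesis
    using \<open>\<beta> \<ge> 0\<close> by (intro norm_blinfun_bound) auto
qed

text \<open>The inverse of \<open>F\<close> on its range is Lipschitz with constant
  \<open>1 / \<nu>\<close>, so the Cauchy property of the convergent residuals passes to the
  iterates.\<close>

lemma strongly_monotone_residual_null_Cauchy: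
  assumes "strongly_monotone F" and null: "(\<lambda>n. F (u n)) \<longlonglongrightarrow> 0"
  shows "Cauchy u"
proof -
  obtain \<nu> where "\<nu> > 0" and \<nu>: "\<And>u v. \<nu> * norm (u - v) \<le> norm (F u - F v)"
    using strongly_monotone_norm_le[OF assms(1)] by blast
  show ?thesis
  proof (rule metric_CauchyI)
    fix e :: real assume "e > 0"
    with \<open>\<nu> > 0\<close> have "\<nu> * e > 0" by simp
    with LIMSEQ_imp_Cauchy[OF null]
    obtain M where M: "\<forall>m\<ge>M. \<forall>n\<ge>M. dist (F (u m)) (F (u n)) < \<nu> * e"
      by (meson metric_CauchyD)
    have "dist (u m) (u n) < e" if "m \<ge> M" "n \<ge> M" for m n
    proof -
      have "\<nu> * dist (u m) (u n) < \<nu> * e"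
        using \<nu>[of "u m" "u n"] M that by (fastforce simp: dist_norm)
      then show ?thesis using \<open>\<nu> > 0\<close> by simp
    qed
    then show "\<exists>M. \<forall>m\<ge>M. \<forall>n\<ge>M. dist (u m) (u n) < e" by blast
  qed
qed

theorem theorem2p7:
  fixes F :: "'a::{real_inner, complete_space} \<Rightarrow> 'a dual"
    and A :: "'a \<Rightarrow> 'a \<Rightarrow> 'a dual"
    and H :: "'a \<Rightarrow> real"
    and \<alpha> \<beta> :: real
    and u :: "nat \<Rightarrow> 'a"
  assumes F1: "lipschitz_operator F"
    and F2: "strongly_monotone F"
    and F3: "potential_of H F"
    and A_linear: "\<And>v. linear (A v)"
    and A_invertible: "\<And>v. bij (A v)"
    and alpha: "\<alpha> > 0" and coercive: "uniformly_coercive (lin_form A) \<alpha>"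
    and beta: "\<beta> > 0" and bounded: "uniformly_bounded (lin_form A) \<beta>"
    and scheme: "linearization_scheme A F u"
    and F4: "energy_decay H u"
  shows "(\<exists>!v. F v = 0) \<and> u \<longlonglongrightarrow> (THE v. F v = 0)"
proof -
  have "(\<lambda>n. norm (u (Suc n) - u n)) \<longlonglongrightarrow> 0"
    using energy_decay_increments_null[OF F4] strongly_monotone_potential_bdd_below[OF F3 F2] .
  then have "(\<lambda>n. \<beta> * norm (u (Suc n) - u n)) \<longlonglongrightarrow> 0"
    by (rule tendsto_mult_right_zero)
  then have null: "(\<lambda>n. F (u n)) \<longlonglongrightarrow> 0"
    by (rule Lim_null_comparison[rotated])
      (use linearization_scheme_residual_le[OF scheme A_linear bounded] beta in simp)
  \<comment> \<open>Completeness of the space supplies the limit, which is the candidate for the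
    zero of \<open>F\<close>.\<close>
  then obtain v where v: "u \<longlonglongrightarrow> v"
    using strongly_monotone_residual_null_Cauchy[OF F2] Cauchy_convergent convergentD by blast
  have "(\<lambda>n. F (u n)) \<longlonglongrightarrow> F v"
    using continuous_on_tendsto_compose[OF lipschitz_operator_continuous[OF F1] v] by simp
  with null have "F v = 0" by (metis LIMSEQ_unique)
  then have unique: "w = v" if "F w = 0" for w
    using strongly_monotone_inj[OF F2] that by (simp add: inj_eq injD)
  have "(THE v. F v = 0) = v"
    using \<open>F v = 0\<close> unique by (rule the_equality)
  moreover have "\<exists>!v. F v = 0"
    using \<open>F v = 0\<close> unique by (rule ex1I)
  ultimately show ?thesis using v by simp
qed

end
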